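(* Let $\mathcal G$ be a grammar on vocabulary $V$, and let ${\to}\mathcal G$ be a suffix-constrained grammar of $\mathcal G$, i.e. a grammar on $V$ whose language is $\operatorname{lang}({\to}\mathcal G) = \{ \bm{u} \odot \bm{w} \mid \bm{u} \in V^*,\ \bm{w} \in \operatorname{lang}(\mathcal G)\}$. Then for every $\bm{y} \in \operatorname{pref}({\to}\mathcal G)$ we have $\operatorname{next}_{{\to}\mathcal G}(\bm{y}) = V$.
   Context: $V$ is a set of tokens (the vocabulary), $V^*$ is the set of all finite sequences over $V$ (including the empty sequence $\epsilon$), $\odot$ denotes concatenation of sequences, and $\langle v \rangle$ is the one-element sequence consisting of the token $v$. A grammar $\mathcal G$ on $V$ is a formal grammar generating a language $\operatorname{lang}(\mathcal G) \subseteq V^*$; all notions below depend on the grammar only through this language. Prefix language: for a grammar $\mathcal G$ on $V$, $\operatorname{pref}(\mathcal G) = \{ \bm{u} \in V^* \mid \exists \bm{v} \in V^* : \bm{u} \odot \bm{v} \in \operatorname{lang}(\mathcal G) \}$. Transition operator: for a grammar $\mathcal G$ on $V$ and $\bm{y} \in \operatorname{pref}(\mathcal G)$, $\operatorname{next}_{\mathcal G}(\bm{y}) = \{ v \in V \mid \bm{y} \odot \langle v \rangle \in \operatorname{pref}(\mathcal G) \}$. These definitions apply to any grammar on $V$, in particular to ${\to}\mathcal G$. *)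

theory Defs
  imports Main
begin

datatype ('n, 'v) symbol = Nt 'n | Tm 'v

record ('n, 'v) grammar =
  nonterminals :: "'n set"
  productions :: "(('n, 'v) symbol list \<times> ('n, 'v) symbol list) set"
  start :: 'n

definition symbols_on :: "'v set \<Rightarrow> ('n, 'v) grammar \<Rightarrow> ('n, 'v) symbol set" where
  "symbols_on V G = Nt ` nonterminals G \<union> Tm ` V"

(* Unrestricted grammars over the terminal alphabet V. As V is an arbitrary set of tokens, neither
   nonterminals nor productions are required to be finite. Hence every language over V is generated
   by some grammar on V, and no more special kind of grammar (e.g. context-free) is left out. *)
definition grammar_on :: "'v set \<Rightarrow> ('n, 'v) grammar \<Rightarrow> bool" where
  "grammar_on V G \<longleftrightarrow>
     start G \<in> nonterminals G \<and>
     (\<forall>(l, r) \<in> productions G.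
        l \<in> lists (symbols_on V G) \<and> r \<in> lists (symbols_on V G) \<and> (\<exists>A. Nt A \<in> set l))"

inductive derives1 :: "('n, 'v) grammar \<Rightarrow> ('n, 'v) symbol list \<Rightarrow> ('n, 'v) symbol list \<Rightarrow> bool"
  for G where
  "(l, r) \<in> productions G \<Longrightarrow> derives1 G (x @ l @ y) (x @ r @ y)"

definition lang :: "('n, 'v) grammar \<Rightarrow> 'v list set" where
  "lang G = {w. (derives1 G)\<^sup>*\<^sup>* [Nt (start G)] (map Tm w)}"

lemma lang_subset_lists:
  assumes "grammar_on V G"
  shows "lang G \<subseteq> lists V"
proof
  fix w assume "w \<in> lang G"
  then have "(derives1 G)\<^sup>*\<^sup>* [Nt (start G)] (map Tm w)"
    by (simp add: lang_def)
  then have "map Tm w \<in> lists (symbols_on V G)"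
  proof (induction rule: rtranclp_induct)
    case base
    show ?case using assms by (simp add: grammar_on_def symbols_on_def)
  next
    case (step a b)
    then show ?case using assms by (fastforce elim!: derives1.cases simp: grammar_on_def)
  qed
  then show "w \<in> lists V"
    by (auto simp: symbols_on_def)
qed

definition pref :: "'v set \<Rightarrow> ('n, 'v) grammar \<Rightarrow> 'v list set" where
  "pref V G = {u \<in> lists V. \<exists>v \<in> lists V. u @ v \<in> lang G}"

definition next_tokens :: "'v set \<Rightarrow> ('n, 'v) grammar \<Rightarrow> 'v list \<Rightarrow> 'v set" where
  "next_tokens V G y = {v \<in> V. y @ [v] \<in> pref V G}"

(* The two grammars may use different types of nonterminals. *)
definition suffix_constrained :: "'v set \<Rightarrow> ('n, 'v) grammar \<Rightarrow> ('m, 'v) grammar \<Rightarrow> bool" where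
  "suffix_constrained V G G' \<longleftrightarrow>
     grammar_on V G' \<and> lang G' = {u @ w | u w. u \<in> lists V \<and> w \<in> lang G}"

end

(* A word w of lang G exists as soon as y is a prefix of some word of the suffix-constrained
   language; then every u over V is such a prefix, being completed by w itself. *)
theory Submission
  imports Defs
begin

text \<open>By \<open>pref_suffix_constrained\<close>, being a prefix imposes nothing beyond being a
  word over \<open>V\<close> once \<open>lang G\<close> is nonempty. Hence appending any token of
  \<open>V\<close> to \<open>y\<close> yields a prefix again.\<close>

lemma pref_suffix_constrained:
  assumes G: "grammar_on V G" and SG: "suffix_constrained V G SG" and ne: "lang G \<noteq> {}"
  shows "pref V SG = lists V"
proof
  show "pref V SG \<subseteq> lists V"
    by (auto simp: pref_def)
  show "lists V \<subseteq> pref V SG"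
  proof
    fix u assume u: "u \<in> lists V"
    obtain w where w: "w \<in> lang G"
      using ne by blast
    \<comment> \<open>\<open>pref\<close> admits only completions over \<open>V\<close>; this is
      where \<open>grammar_on V G\<close> enters.\<close>
    then have "w \<in> lists V"
      using lang_subset_lists[OF G] by blast
    moreover have "u @ w \<in> lang SG"
      using SG u w unfolding suffix_constrained_def by blast
    ultimately show "u \<in> pref V SG"
      using u unfolding pref_def by blast
  qed
qed

theorem proposition1:
  fixes V :: "'v set" and G :: "('n, 'v) grammar" and SG :: "('m, 'v) grammar"
  assumes "grammar_on V G"
    and "suffix_constrained V G SG"
    and "y \<in> pref V SG"
  shows "next_tokens V SG y = V"
proof -
  \<comment> \<open>Some completion of \<open>y\<close> lies in \<open>lang SG\<close>, so it ends
    in a word of \<open>lang G\<close>.\<close>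
  have "lang G \<noteq> {}"
    using assms(2,3) unfolding pref_def suffix_constrained_def by blast
  with assms have "pref V SG = lists V"
    by (intro pref_suffix_constrained)
  with assms(3) show ?thesis
    by (auto simp: next_tokens_def)
qed

end
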